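(* Let $p$ be a prime, let $G$ be a finite $p$-group of nilpotency class $2$, and let $w$ be a word in two variables. Then $N_w(g) \geq |G|$ for all $g \in G_w$.
   Context: A word $w$ in $k$ variables $x_1,\ldots,x_k$ is an element of the free group $F_k$ on $x_1,\ldots,x_k$. For elements $g_1,\ldots,g_k$ of a group $G$, $w(g_1,\ldots,g_k)\in G$ denotes the image of $w$ under the homomorphism $F_k\to G$ sending $x_i\mapsto g_i$ for $1\le i\le k$. Write $G^{(k)}$ for the direct product of $k$ copies of $G$. The set of $w$-values is $G_w=\{w(g_1,\ldots,g_k) : (g_1,\ldots,g_k)\in G^{(k)}\}$. For a finite group $G$ and $g\in G$, $N_w(g)=N_{w,G}(g)=|\{(g_1,\ldots,g_k)\in G^{(k)} : w(g_1,\ldots,g_k)=g\}|$. In the claim, $k=2$. *)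

theory Defs
  imports
    "HOL-Algebra.Product_Groups"
    "HOL-Computational_Algebra.Primes"
begin

section \<open>Free groups of finite rank\<close>

text \<open>The letter \<open>(i, True)\<close> stands for $x_i$ and \<open>(i, False)\<close> for its inverse. The free group on
  $x_1, \dots, x_k$ is realised on the reduced words in these letters; the product is
  concatenation followed by free reduction.\<close>

type_synonym letter = "nat \<times> bool"

definition inv_letter :: "letter \<Rightarrow> letter"
  where "inv_letter a = (fst a, \<not> snd a)"

definition reduced :: "letter list \<Rightarrow> bool"
  where "reduced = successively (\<lambda>a b. b \<noteq> inv_letter a)"

fun push_letter :: "letter \<Rightarrow> letter list \<Rightarrow> letter list"
  where
    "push_letter a [] = [a]"
  | "push_letter a (b # w) = (if b = inv_letter a then w else a # b # w)"

definition free_group :: "nat \<Rightarrow> letter list monoid"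
  where "free_group k =
    \<lparr>carrier = {w. reduced w \<and> fst ` set w \<subseteq> {1..k}},
     monoid.mult = (\<lambda>u v. foldr push_letter u v),
     one = []\<rparr>"

lemma inv_letter_simps [simp]:
  "inv_letter (inv_letter a) = a" "fst (inv_letter a) = fst a"
  "inv_letter a \<noteq> a" "a \<noteq> inv_letter a"
  by (auto simp: inv_letter_def prod_eq_iff)

lemma reduced_simps [simp]:
  "reduced []" "reduced [a]"
  "reduced (a # b # w) \<longleftrightarrow> b \<noteq> inv_letter a \<and> reduced (b # w)"
  by (simp_all add: reduced_def)

lemma reduced_ConsD: "reduced (a # w) \<Longrightarrow> reduced w"
  by (cases w) auto

lemma reduced_push: "reduced w \<Longrightarrow> reduced (push_letter a w)"
  by (cases w) (auto dest: reduced_ConsD)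

lemma reduced_foldr_push: "reduced v \<Longrightarrow> reduced (foldr push_letter u v)"
  by (induction u) (auto intro: reduced_push)

lemma set_push: "set (push_letter a w) \<subseteq> insert a (set w)"
  by (cases w) auto

lemma set_foldr_push: "set (foldr push_letter u v) \<subseteq> set u \<union> set v"
  by (induction u) (use set_push in fastforce)+

lemma push_inv_cancel: "reduced w \<Longrightarrow> push_letter a (push_letter (inv_letter a) w) = w"
proof (cases w)
  case (Cons b v)
  assume "reduced w"
  then show ?thesis using Cons by (cases v) auto
qed auto

lemma foldr_push_push:
  assumes "reduced v"
  shows "foldr push_letter (push_letter a u) v = push_letter a (foldr push_letter u v)"
  using push_inv_cancel[OF reduced_foldr_push[OF assms]] by (cases u) auto

lemma foldr_push_assoc:
  assumes "reduced w"
  shows "foldr push_letter (foldr push_letter u v) w =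
    foldr push_letter u (foldr push_letter v w)"
  by (induction u) (auto simp: foldr_push_push[OF assms])

lemma foldr_push_Nil: "reduced u \<Longrightarrow> foldr push_letter u [] = u"
proof (induction u)
  case (Cons a u)
  then show ?case by (cases u) (auto dest: reduced_ConsD)
qed simp

lemma foldr_push_inverse:
  assumes "reduced v"
  shows "foldr push_letter (rev (map inv_letter u)) (foldr push_letter u v) = v"
proof (induction u)
  case (Cons a u)
  show ?case
    using Cons push_inv_cancel[OF reduced_foldr_push[OF assms], of "inv_letter a"] by simp
qed simp

lemma reduced_rev_inverse: "reduced u \<Longrightarrow> reduced (rev (map inv_letter u))"
  unfolding reduced_def successively_rev successively_map
  by (erule successively_mono) (metis inv_letter_simps(1))

lemma group_free_group: "group (free_group k)"
proof (rule groupI)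
  fix u assume u: "u \<in> carrier (free_group k)"
  then have "rev (map inv_letter u) \<in> carrier (free_group k)"
    by (auto simp: free_group_def reduced_rev_inverse)
  moreover have "rev (map inv_letter u) \<otimes>\<^bsub>free_group k\<^esub> u = \<one>\<^bsub>free_group k\<^esub>"
    using u foldr_push_inverse[of "[]" u] by (simp add: free_group_def foldr_push_Nil)
  ultimately show "\<exists>v \<in> carrier (free_group k). v \<otimes>\<^bsub>free_group k\<^esub> u = \<one>\<^bsub>free_group k\<^esub>"
    by blast
next
  fix u v assume "u \<in> carrier (free_group k)" "v \<in> carrier (free_group k)"
  then show "u \<otimes>\<^bsub>free_group k\<^esub> v \<in> carrier (free_group k)"
    using set_foldr_push[of u v] by (force simp: free_group_def reduced_foldr_push)
qed (auto simp: free_group_def foldr_push_assoc)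


section \<open>Word maps\<close>

definition letter_value :: "('a, 'b) monoid_scheme \<Rightarrow> (nat \<Rightarrow> 'a) \<Rightarrow> letter \<Rightarrow> 'a"
  where "letter_value G g a = (if snd a then g (fst a) else inv\<^bsub>G\<^esub> (g (fst a)))"

text \<open>\<open>word_value G w g\<close> is $w(g_1, \dots, g_k)$. Lemmas \<open>word_value_hom\<close>,
  \<open>word_value_generator\<close> and \<open>word_value_unique\<close> below identify it with the
  image of $w$ under the unique homomorphism from the free group to $G$ that sends each $x_i$
  to $g_i$.\<close>

definition word_value :: "('a, 'b) monoid_scheme \<Rightarrow> letter list \<Rightarrow> (nat \<Rightarrow> 'a) \<Rightarrow> 'a"
  where "word_value G w g = foldr (\<lambda>a x. letter_value G g a \<otimes>\<^bsub>G\<^esub> x) w \<one>\<^bsub>G\<^esub>"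

definition direct_power :: "('a, 'b) monoid_scheme \<Rightarrow> nat \<Rightarrow> (nat \<Rightarrow> 'a) monoid"
  where "direct_power G k = product_group {1..k} (\<lambda>_. G)"

definition word_values :: "('a, 'b) monoid_scheme \<Rightarrow> nat \<Rightarrow> letter list \<Rightarrow> 'a set"
  where "word_values G k w = {word_value G w g | g. g \<in> carrier (direct_power G k)}"

definition word_count :: "('a, 'b) monoid_scheme \<Rightarrow> nat \<Rightarrow> letter list \<Rightarrow> 'a \<Rightarrow> nat"
  where "word_count G k w x = card {g \<in> carrier (direct_power G k). word_value G w g = x}"

context group
begin

lemma letter_value_closed:
  assumes "g \<in> carrier (direct_power G k)" "fst a \<in> {1..k}"
  shows "letter_value G g a \<in> carrier G"
  using assms by (auto simp: letter_value_def direct_power_def PiE_iff)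

lemma word_value_closed:
  assumes "g \<in> carrier (direct_power G k)" "fst ` set w \<subseteq> {1..k}"
  shows "word_value G w g \<in> carrier G"
  using assms(2)
  by (induction w) (auto simp: word_value_def intro!: m_closed letter_value_closed[OF assms(1)])

lemma word_value_push:
  assumes g: "g \<in> carrier (direct_power G k)" and w: "fst ` set (a # w) \<subseteq> {1..k}"
  shows "word_value G (push_letter a w) g = letter_value G g a \<otimes> word_value G w g"
proof (cases w)
  case (Cons b v)
  show ?thesis
  proof (cases "b = inv_letter a")
    case True
    have a: "g (fst a) \<in> carrier G" and v: "word_value G v g \<in> carrier G"
      using g w Cons by (auto simp: direct_power_def intro!: word_value_closed[OF g])
    have "letter_value G g a \<otimes> letter_value G g b = \<one>"
      using a True by (auto simp: letter_value_def inv_letter_def)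
    moreover have "letter_value G g a \<in> carrier G" "letter_value G g b \<in> carrier G"
      using w Cons by (auto intro!: letter_value_closed[OF g])
    ultimately show ?thesis
      using True Cons v m_assoc[of "letter_value G g a" "letter_value G g b" "word_value G v g"]
      by (simp add: word_value_def)
  qed (simp add: Cons word_value_def)
qed (simp add: word_value_def)

lemma word_value_hom:
  assumes g: "g \<in> carrier (direct_power G k)"
  shows "(\<lambda>w. word_value G w g) \<in> hom (free_group k) G"
proof (rule homI)
  fix u v assume "u \<in> carrier (free_group k)" and v: "v \<in> carrier (free_group k)"
  then have "fst ` set u \<subseteq> {1..k}" by (simp add: free_group_def)
  then have "word_value G (foldr push_letter u v) g = word_value G u g \<otimes> word_value G v g"
  proof (induction u)
    case Nil
    then show ?case
      using v word_value_closed[OF g, of v] by (simp add: free_group_def word_value_def)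
  next
    case (Cons a u)
    have "fst ` set (a # foldr push_letter u v) \<subseteq> {1..k}"
      using Cons.prems v set_foldr_push[of u v] by (force simp: free_group_def)
    moreover have "letter_value G g a \<in> carrier G" "word_value G u g \<in> carrier G"
      "word_value G v g \<in> carrier G"
      using Cons.prems v
      by (auto simp: free_group_def intro!: letter_value_closed[OF g] word_value_closed[OF g])
    ultimately show ?case
      using Cons word_value_push[OF g]
        m_assoc[of "letter_value G g a" "word_value G u g" "word_value G v g"]
      by (simp add: word_value_def)
  qed
  then show "word_value G (u \<otimes>\<^bsub>free_group k\<^esub> v) g = word_value G u g \<otimes> word_value G v g"
    by (simp add: free_group_def)
qed (auto simp: free_group_def intro!: word_value_closed[OF g])

lemma word_value_generator:
  assumes "g \<in> carrier (direct_power G k)" "i \<in> {1..k}"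
  shows "word_value G [(i, True)] g = g i"
  using assms by (auto simp: word_value_def letter_value_def direct_power_def PiE_iff)

lemma word_value_unique:
  assumes h: "h \<in> hom (free_group k) G"
    and g: "\<And>i. i \<in> {1..k} \<Longrightarrow> h [(i, True)] = g i"
    and w: "w \<in> carrier (free_group k)"
  shows "h w = word_value G w g"
proof -
  interpret F: group "free_group k" by (rule group_free_group)
  interpret h: group_hom "free_group k" G h
    by unfold_locales (rule h)
  have letter: "h [a] = letter_value G g a" if "fst a \<in> {1..k}" for a
  proof (cases "snd a")
    case True
    then have "a = (fst a, True)" by (simp add: prod_eq_iff)
    then show ?thesis using g[OF that] True by (metis letter_value_def)
  next
    case False
    have x: "[(fst a, True)] \<in> carrier (free_group k)" and y: "[a] \<in> carrier (free_group k)"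
      using that by (auto simp: free_group_def)
    have "[a] \<otimes>\<^bsub>free_group k\<^esub> [(fst a, True)] = \<one>\<^bsub>free_group k\<^esub>"
      using False by (simp add: free_group_def inv_letter_def)
    then have "[a] = inv\<^bsub>free_group k\<^esub> [(fst a, True)]"
      using x y F.inv_equality by metis
    then have "h [a] = inv (h [(fst a, True)])"
      using h.hom_inv[OF x] by simp
    then show ?thesis using g[OF that] False by (simp add: letter_value_def)
  qed
  show ?thesis
    using w
  proof (induction w)
    case Nil
    then show ?case using h.hom_one by (simp add: free_group_def word_value_def)
  next
    case (Cons a w)
    then have a: "[a] \<in> carrier (free_group k)" "fst a \<in> {1..k}"
      and w: "w \<in> carrier (free_group k)"
      by (auto simp: free_group_def dest: reduced_ConsD)
    have "a # w = [a] \<otimes>\<^bsub>free_group k\<^esub> w"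
      using Cons.prems by (cases w) (auto simp: free_group_def)
    then have "h (a # w) = letter_value G g a \<otimes> word_value G w g"
      using h.hom_mult[OF a(1) w] letter[OF a(2)] Cons.IH[OF w] by metis
    then show ?case by (simp add: word_value_def)
  qed
qed

end


section \<open>Nilpotency class\<close>

definition commutator_subgroup :: "('a, 'b) monoid_scheme \<Rightarrow> 'a set \<Rightarrow> 'a set \<Rightarrow> 'a set"
  where "commutator_subgroup G H K =
    generate G {x \<otimes>\<^bsub>G\<^esub> y \<otimes>\<^bsub>G\<^esub> inv\<^bsub>G\<^esub> x \<otimes>\<^bsub>G\<^esub> inv\<^bsub>G\<^esub> y | x y. x \<in> H \<and> y \<in> K}"

text \<open>Indexed from 0: \<open>lower_central G n\<close> is $\gamma_{n+1}(G)$.\<close>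

primrec lower_central :: "('a, 'b) monoid_scheme \<Rightarrow> nat \<Rightarrow> 'a set"
  where
    "lower_central G 0 = carrier G"
  | "lower_central G (Suc n) = commutator_subgroup G (lower_central G n) (carrier G)"

definition has_nilpotency_class :: "('a, 'b) monoid_scheme \<Rightarrow> nat \<Rightarrow> bool"
  where "has_nilpotency_class G c \<longleftrightarrow>
    lower_central G c = {\<one>\<^bsub>G\<^esub>} \<and> (\<forall>n<c. lower_central G n \<noteq> {\<one>\<^bsub>G\<^esub>})"

text \<open>For finite groups.\<close>

definition finite_p_group :: "nat \<Rightarrow> ('a, 'b) monoid_scheme \<Rightarrow> bool"
  where "finite_p_group p G \<longleftrightarrow> group G \<and> finite (carrier G) \<and> (\<exists>n. order G = p ^ n)"

end

theory Submission
  imports Defs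
begin

text \<open>In a group of class 2, a word in two variables takes the value
  $x^a y^b [x, y]^c$ with integers $a$, $b$, $c$ that depend on the word only. The substitutions
  $x \mapsto x y^k$ and swapping the variables are bijections on pairs and act on $(a, b)$ by
  Euclid's algorithm, so one may assume $b = 0$. If then $x_0^a [x_0, y_0]^c = g$, let $\theta$ be
  the homomorphism $u \mapsto [x_0, u]^c$ into the centre. For $z$ in the image of $\theta$, the
  pair $(x_0 z, y)$ is a solution if and only if $\theta(y) = \theta(y_0) z^{-a}$, so it has as
  many solutions $y$ as $\theta$ has kernel elements. These are $|G|$ solutions in total.\<close>

section \<open>Commutator calculus when all commutators are central\<close>

locale class_two_group = group G for G (structure) +
  assumes commutator_central:
    "\<lbrakk>x \<in> carrier G; y \<in> carrier G; z \<in> carrier G\<rbrakk> \<Longrightarrow>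
      (x \<otimes> y \<otimes> inv x \<otimes> inv y) \<otimes> z = z \<otimes> (x \<otimes> y \<otimes> inv x \<otimes> inv y)"
begin

definition commutator :: "'a \<Rightarrow> 'a \<Rightarrow> 'a"
  where "commutator x y = x \<otimes> y \<otimes> inv x \<otimes> inv y"

definition collected :: "int \<Rightarrow> int \<Rightarrow> int \<Rightarrow> 'a \<Rightarrow> 'a \<Rightarrow> 'a"
  where "collected a b c x y = x [^] a \<otimes> (y [^] b \<otimes> commutator x y [^] c)"

text \<open>Solutions are kept as pairs, so that substitutions become plain maps of pairs; the
  passage to functions on \<open>{1..2}\<close> is made once, in
  \<open>word_count_ge_order\<close>.\<close>

definition solutions :: "int \<Rightarrow> int \<Rightarrow> int \<Rightarrow> 'a \<Rightarrow> ('a \<times> 'a) set"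
  where "solutions a b c g =
    {(x, y). x \<in> carrier G \<and> y \<in> carrier G \<and> collected a b c x y = g}"

lemma commutator_closed [simp, intro]:
  "x \<in> carrier G \<Longrightarrow> y \<in> carrier G \<Longrightarrow> commutator x y \<in> carrier G"
  by (simp add: commutator_def)

lemma commutator_swap:
  assumes x: "x \<in> carrier G" and y: "y \<in> carrier G"
  shows "x \<otimes> y = commutator x y \<otimes> (y \<otimes> x)"
proof -
  have "commutator x y \<otimes> (y \<otimes> x) = x \<otimes> y \<otimes> (inv x \<otimes> (inv y \<otimes> y) \<otimes> x)"
    unfolding commutator_def using assms by (simp only: m_assoc m_closed inv_closed)
  also have "\<dots> = x \<otimes> y"
    using assms by simp
  finally show ?thesis ..
qed

text \<open>Cancelling \<open>y \<otimes> x\<close> determines \<open>c\<close>. Commutator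
  identities then reduce to reordering products, with no inverses to handle.\<close>

lemma commutator_unique:
  assumes "x \<in> carrier G" "y \<in> carrier G" "c \<in> carrier G" "x \<otimes> y = c \<otimes> (y \<otimes> x)"
  shows "commutator x y = c"
  using assms commutator_swap[of x y] by (metis commutator_closed m_closed right_cancel)

lemma commutator_commute:
  assumes "x \<in> carrier G" "y \<in> carrier G" "z \<in> carrier G"
  shows "z \<otimes> commutator x y = commutator x y \<otimes> z"
  using commutator_central[OF assms] by (simp add: commutator_def)

lemma commutator_self [simp]: "x \<in> carrier G \<Longrightarrow> commutator x x = \<one>"
  by (rule commutator_unique) auto

lemma commutator_inv:
  assumes x: "x \<in> carrier G" and y: "y \<in> carrier G"
  shows "commutator y x = inv (commutator x y)"
proof (rule commutator_unique[OF y x])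
  show "y \<otimes> x = inv (commutator x y) \<otimes> (x \<otimes> y)"
    using x y commutator_swap[OF x y] by (simp add: inv_solve_left)
qed (use x y in simp)

text \<open>Move \<open>y\<close> leftwards past \<open>u\<close> and then past \<open>x\<close>;
  each move leaves behind one central commutator.\<close>

lemma commutator_mult_left:
  assumes "x \<in> carrier G" "u \<in> carrier G" "y \<in> carrier G"
  shows "commutator (x \<otimes> u) y = commutator x y \<otimes> commutator u y"
proof (rule commutator_unique)
  have "x \<otimes> u \<otimes> y = x \<otimes> commutator u y \<otimes> (y \<otimes> u)"
    using assms commutator_swap[of u y] by (simp add: m_assoc)
  also have "\<dots> = commutator u y \<otimes> (x \<otimes> y) \<otimes> u"
    using assms commutator_commute[of u y x] by (simp add: m_assoc)
  also have "\<dots> = commutator u y \<otimes> commutator x y \<otimes> (y \<otimes> x) \<otimes> u"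
    using assms commutator_swap[of x y] by (simp add: m_assoc)
  finally show "x \<otimes> u \<otimes> y = commutator x y \<otimes> commutator u y \<otimes> (y \<otimes> (x \<otimes> u))"
    using assms commutator_commute[of u y "commutator x y"] by (simp add: m_assoc)
qed (use assms in auto)

text \<open>By \<open>commutator_mult_left\<close> the map \<open>x \<mapsto> [x, y]\<close> is an
  endomorphism of the group, so it respects integer powers, negative ones included.\<close>

lemma commutator_pow_left:
  assumes x: "x \<in> carrier G" and y: "y \<in> carrier G"
  shows "commutator (x [^] (n::int)) y = commutator x y [^] n"
  using assms commutator_mult_left
  by (intro hom_int_pow[where h = "\<lambda>x. commutator x y"] homI) auto

lemma commutator_pow_right:
  assumes x: "x \<in> carrier G" and y: "y \<in> carrier G"
  shows "commutator x (y [^] (n::int)) = commutator x y [^] n"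
  using assms commutator_inv[of _ x] by (simp add: commutator_pow_left int_pow_inv)

text \<open>A power \<open>[x, y]^n\<close> is itself the commutator \<open>[x^n, y]\<close>, hence
  central.\<close>

lemma commutator_pow_commute:
  assumes "x \<in> carrier G" "y \<in> carrier G" "z \<in> carrier G"
  shows "z \<otimes> commutator x y [^] (n::int) = commutator x y [^] n \<otimes> z"
  using commutator_commute[of "x [^] n" y z] assms by (simp add: commutator_pow_left)

lemma commutator_mult_right:
  assumes "x \<in> carrier G" "y \<in> carrier G" "u \<in> carrier G"
  shows "commutator x (y \<otimes> u) = commutator x y \<otimes> commutator x u"
  using assms commutator_inv[of _ x] commutator_commute[of x u "commutator x y"]
  by (simp add: commutator_mult_left inv_mult_group)

section \<open>Arithmetic of the normal form \<open>x^a y^b [x, y]^c\<close>\<close>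

lemma collected_closed [simp, intro]:
  "x \<in> carrier G \<Longrightarrow> y \<in> carrier G \<Longrightarrow> collected a b c x y \<in> carrier G"
  by (simp add: collected_def)

text \<open>Bilinearity gives \<open>[y^b, x^a] = [y, x]^(b a) = [x, y]^(- b a)\<close>.\<close>

lemma pow_swap:
  assumes x: "x \<in> carrier G" and y: "y \<in> carrier G"
  shows "y [^] (b::int) \<otimes> x [^] (a::int) = x [^] a \<otimes> (y [^] b \<otimes> commutator x y [^] (- (b * a)))"
proof -
  have "y [^] b \<otimes> x [^] a = commutator (y [^] b) (x [^] a) \<otimes> (x [^] a \<otimes> y [^] b)"
    using x y by (intro commutator_swap) auto
  also have "commutator (y [^] b) (x [^] a) = commutator x y [^] (- (b * a))"
    using x y commutator_inv[OF x y]
    by (simp add: commutator_pow_left commutator_pow_right int_pow_pow int_pow_inv int_pow_neg)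
  finally show ?thesis
    using x y commutator_pow_commute[OF x y, of "x [^] a \<otimes> y [^] b"] by (simp add: m_assoc)
qed

text \<open>The exponent triples multiply as in the integer Heisenberg group: the correction
  \<open>- b * a'\<close> arises when \<open>y^b\<close> passes \<open>x^a'\<close>, and all other
  moves involve central factors.\<close>

lemma collected_mult:
  assumes x: "x \<in> carrier G" and y: "y \<in> carrier G"
  shows "collected a b c x y \<otimes> collected a' b' c' x y =
    collected (a + a') (b + b') (c + c' - b * a') x y"
proof -
  let ?K = "\<lambda>n::int. commutator x y [^] n"
  \<comment> \<open>In these three rules the trailing factor \<open>t\<close> lets them act inside
    right-nested products.\<close>
  have K: "?K n \<otimes> (v \<otimes> t) = v \<otimes> (?K n \<otimes> t)" if "v \<in> carrier G" "t \<in> carrier G" for n v t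
    using that x y commutator_pow_commute[OF x y, of v n] by (simp flip: m_assoc)
  have swap: "y [^] b \<otimes> (x [^] a' \<otimes> t) = x [^] a' \<otimes> (y [^] b \<otimes> (?K (- (b * a')) \<otimes> t))"
    if "t \<in> carrier G" for t
    using that x y pow_swap[OF x y, of b a'] by (simp flip: m_assoc)
  have add: "z [^] m \<otimes> (z [^] n \<otimes> t) = z [^] (m + n) \<otimes> t"
    if "z \<in> carrier G" "t \<in> carrier G" for z t and m n :: int
    using that by (simp add: int_pow_mult m_assoc)
  have "collected a b c x y \<otimes> collected a' b' c' x y =
    x [^] a \<otimes> (y [^] b \<otimes> (x [^] a' \<otimes> (y [^] b' \<otimes> (?K c \<otimes> ?K c'))))"
    using x y by (simp add: collected_def m_assoc K[of "x [^] a'"] K[of "y [^] b'"])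
  also have "\<dots> = x [^] (a + a') \<otimes> (y [^] (b + b') \<otimes> ?K (c + c' - b * a'))"
    using x y by (simp add: swap K[of "y [^] b'"] add algebra_simps flip: int_pow_mult)
  finally show ?thesis
    by (simp add: collected_def)
qed

lemma collected_zero [simp]:
  "x \<in> carrier G \<Longrightarrow> y \<in> carrier G \<Longrightarrow> collected 0 0 0 x y = \<one>"
  by (simp add: collected_def)

lemma collected_inv:
  assumes x: "x \<in> carrier G" and y: "y \<in> carrier G"
  shows "inv (collected a b c x y) = collected (- a) (- b) (- c - a * b) x y"
  using x y by (intro inv_equality) (auto simp: collected_mult)

text \<open>Here \<open>x y^k\<close> has the triple \<open>(1, k, 0)\<close>, so induction up and
  down from 0 with the product law gives the power. The order of quantifiers matters:
  \<open>c\<close> depends on \<open>k\<close> and \<open>a\<close> alone, so one exponent serves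
  all pairs.\<close>

lemma collected_pow:
  "\<exists>c. \<forall>x \<in> carrier G. \<forall>y \<in> carrier G. (x \<otimes> y [^] (k::int)) [^] (a::int) = collected a (k * a) c x y"
proof (induction a rule: int_induct[where k = 0])
  case base
  show ?case by (auto intro!: exI[of _ 0])
next
  case (step1 a)
  then obtain c where c: "\<And>x y. x \<in> carrier G \<Longrightarrow> y \<in> carrier G \<Longrightarrow>
    (x \<otimes> y [^] k) [^] a = collected a (k * a) c x y" by blast
  have "(x \<otimes> y [^] k) [^] (a + 1) = collected (a + 1) (k * (a + 1)) (c - k * a) x y"
    if "x \<in> carrier G" "y \<in> carrier G" for x y
  proof -
    have "x \<otimes> y [^] k = collected 1 k 0 x y" using that by (simp add: collected_def)
    then show ?thesis
      using that c[OF that] by (simp add: int_pow_mult collected_mult algebra_simps)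
  qed
  then show ?case by blast
next
  case (step2 a)
  then obtain c where c: "\<And>x y. x \<in> carrier G \<Longrightarrow> y \<in> carrier G \<Longrightarrow>
    (x \<otimes> y [^] k) [^] a = collected a (k * a) c x y" by blast
  have "(x \<otimes> y [^] k) [^] (a - 1) = collected (a - 1) (k * (a - 1)) (c - k + k * a) x y"
    if "x \<in> carrier G" "y \<in> carrier G" for x y
  proof -
    have "x \<otimes> y [^] k = collected 1 k 0 x y" using that by (simp add: collected_def)
    then show ?thesis
      using that c[OF that] by (simp add: int_pow_diff collected_inv collected_mult algebra_simps)
  qed
  then show ?case by blast
qed

text \<open>The substitution \<open>x \<mapsto> x y^k\<close> fixes \<open>[x, y]\<close>, because
  \<open>[y^k, y] = 1\<close>; only the power of \<open>x\<close> has to be expanded.\<close>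

lemma collected_shear:
  "\<exists>c'. \<forall>x \<in> carrier G. \<forall>y \<in> carrier G.
    collected a b c (x \<otimes> y [^] (k::int)) y = collected a (b + k * a) c' x y"
proof -
  obtain m where m: "\<And>x y. x \<in> carrier G \<Longrightarrow> y \<in> carrier G \<Longrightarrow>
    (x \<otimes> y [^] k) [^] a = collected a (k * a) m x y" using collected_pow by blast
  have "collected a b c (x \<otimes> y [^] k) y = collected a (b + k * a) (m + c) x y"
    if x: "x \<in> carrier G" and y: "y \<in> carrier G" for x y
  proof -
    have "commutator (x \<otimes> y [^] k) y = commutator x y"
      using x y by (simp add: commutator_mult_left commutator_pow_left)
    moreover have "y [^] b \<otimes> commutator x y [^] c = collected 0 b c x y"
      using x y by (simp add: collected_def)
    ultimately have "collected a b c (x \<otimes> y [^] k) y =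
        collected a (k * a) m x y \<otimes> collected 0 b c x y"
      using m[OF x y] by (simp add: collected_def)
    then show ?thesis using x y by (simp add: collected_mult add.commute)
  qed
  then show ?thesis by blast
qed

text \<open>Swapping inverts the commutator, whence \<open>- c\<close>; moving \<open>x^b\<close> in
  front of \<open>y^a\<close> contributes \<open>- a * b\<close>.\<close>

lemma collected_swap:
  assumes x: "x \<in> carrier G" and y: "y \<in> carrier G"
  shows "collected a b c y x = collected b a (- c - a * b) x y"
proof -
  have "collected a b c y x = collected 0 a 0 x y \<otimes> collected b 0 (- c) x y"
    using x y commutator_inv[OF x y] by (simp add: collected_def int_pow_inv int_pow_neg)
  then show ?thesis using x y by (simp add: collected_mult)
qed

section \<open>Two-variable words in normal form\<close>

text \<open>Each letter has a triple \<open>(\<plusminus>1, 0, 0)\<close> or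
  \<open>(0, \<plusminus>1, 0)\<close>, and prepending it is an instance of the product law. The
  exponents are chosen before \<open>g\<close>, so the word map is one and the same
  \<open>collected\<close> function on all pairs.\<close>

lemma word_value_collected:
  assumes "fst ` set w \<subseteq> {1..2}"
  shows "\<exists>a b c. \<forall>g \<in> carrier (direct_power G 2). word_value G w g = collected a b c (g 1) (g 2)"
  using assms
proof (induction w)
  case Nil
  have "word_value G [] g = collected 0 0 0 (g 1) (g 2)"
    if "g \<in> carrier (direct_power G 2)" for g
    using that by (auto simp: word_value_def direct_power_def PiE_iff)
  then show ?case by blast
next
  case (Cons l w)
  then obtain a b c where IH: "\<And>g. g \<in> carrier (direct_power G 2) \<Longrightarrow>
    word_value G w g = collected a b c (g 1) (g 2)" by auto
  obtain i j where l: "\<And>g. g \<in> carrier (direct_power G 2) \<Longrightarrow>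
    letter_value G g l = collected i j 0 (g 1) (g 2)"
  proof -
    have G: "g 1 \<in> carrier G" "g 2 \<in> carrier G" if "g \<in> carrier (direct_power G 2)" for g
      using that by (auto simp: direct_power_def PiE_iff)
    have "fst l = 1 \<or> fst l = 2" using Cons.prems by auto
    then consider "l = (1, True)" | "l = (1, False)" | "l = (2, True)" | "l = (2, False)"
      by (cases l) auto
    then show ?thesis
    proof cases
      case 1 then show ?thesis
        by (intro that[of 1 0]) (auto simp: letter_value_def collected_def dest: G)
    next
      case 2 then show ?thesis
        by (intro that[of "-1" 0]) (auto simp: letter_value_def collected_def int_pow_neg dest: G)
    next
      case 3 then show ?thesis
        by (intro that[of 0 1]) (auto simp: letter_value_def collected_def dest: G)
    next
      case 4 then show ?thesis
        by (intro that[of 0 "-1"]) (auto simp: letter_value_def collected_def int_pow_neg dest: G)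
    qed
  qed
  have "word_value G (l # w) g = collected (i + a) (j + b) (c - j * a) (g 1) (g 2)"
    if g: "g \<in> carrier (direct_power G 2)" for g
  proof -
    have "g 1 \<in> carrier G" "g 2 \<in> carrier G"
      using g by (auto simp: direct_power_def PiE_iff)
    then show ?thesis
      using IH[OF g] l[OF g] by (simp add: word_value_def collected_mult)
  qed
  then show ?case by blast
qed

section \<open>Counting solutions\<close>

lemma finite_solutions: "finite (carrier G) \<Longrightarrow> finite (solutions a b c g)"
  by (rule finite_subset[of _ "carrier G \<times> carrier G"]) (auto simp: solutions_def)

text \<open>Instead of multiplying the sizes of the kernel and the image of \<open>\<theta>\<close>,
  the proof embeds the whole group into the solution set by the single map
  \<open>\<phi>\<close>.\<close>

lemma card_solutions_base:
  assumes fin: "finite (carrier G)" and ne: "solutions a 0 c g \<noteq> {}"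
  shows "order G \<le> card (solutions a 0 c g)"
proof -
  from ne obtain x0 y0 where x0: "x0 \<in> carrier G" and y0: "y0 \<in> carrier G"
    and g: "collected a 0 c x0 y0 = g" by (auto simp: solutions_def)
  define \<theta> where "\<theta> u = commutator x0 u [^] c" for u
  have \<theta>_closed [simp]: "\<theta> u \<in> carrier G" if "u \<in> carrier G" for u
    using that x0 by (simp add: \<theta>_def)
  have \<theta>_commute: "v \<otimes> \<theta> u = \<theta> u \<otimes> v" if "u \<in> carrier G" "v \<in> carrier G" for u v
    using that x0 commutator_pow_commute by (simp add: \<theta>_def)
  \<comment> \<open>Writing \<open>[x0, u]^c\<close> as \<open>[x0^c, u]\<close> reduces this to
    additivity in the second argument.\<close>
  have \<theta>_mult: "\<theta> (u \<otimes> v) = \<theta> u \<otimes> \<theta> v" if "u \<in> carrier G" "v \<in> carrier G" for u v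
    using that x0 commutator_mult_right[of "x0 [^] c" u v]
    by (simp add: \<theta>_def commutator_pow_left)
  have \<theta>_pow: "\<theta> (u [^] n) = \<theta> u [^] n" if "u \<in> carrier G" for u and n :: int
    using that \<theta>_mult by (intro hom_int_pow[where h = \<theta>] homI) auto
  \<comment> \<open>A section of \<open>\<theta>\<close> over its image.\<close>
  define s where "s z = inv_into (carrier G) \<theta> z" for z
  have s [simp]: "s (\<theta> u) \<in> carrier G" "\<theta> (s (\<theta> u)) = \<theta> u" if "u \<in> carrier G" for u
    using that by (auto simp: s_def inv_into_into f_inv_into_f)
  \<comment> \<open>The second coordinate must have \<open>\<theta>\<close>-value
    \<open>\<theta> y0 \<otimes> \<theta> u [^] (- a)\<close>. The factor \<open>u\<close>
    contributes one \<open>\<theta> u\<close>, hence the exponent \<open>- a - 1\<close> on the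
    section. The section sees only \<open>\<theta> u\<close>, which the first coordinate determines,
    so it cancels and \<open>u\<close> can be recovered.\<close>
  define \<phi> where "\<phi> u = (x0 \<otimes> \<theta> u, y0 \<otimes> s (\<theta> u) [^] (- a - 1) \<otimes> u)" for u
  have "inj_on \<phi> (carrier G)"
  proof (rule inj_onI)
    fix u v assume u: "u \<in> carrier G" and v: "v \<in> carrier G" and eq: "\<phi> u = \<phi> v"
    then have "\<theta> u = \<theta> v" using x0 by (simp add: \<phi>_def)
    then show "u = v" using eq u v y0 by (simp add: \<phi>_def)
  qed
  moreover have "\<phi> u \<in> solutions a 0 c g" if u: "u \<in> carrier G" for u
  proof -
    let ?z = "\<theta> u" and ?y = "y0 \<otimes> s (\<theta> u) [^] (- a - 1) \<otimes> u"
    have y: "?y \<in> carrier G" using u y0 by simp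
    \<comment> \<open>As \<open>?z\<close> is central, it drops out of the commutator with
      \<open>?y\<close>.\<close>
    have "commutator ?z ?y = \<one>"
      using u y x0 \<theta>_commute[OF u y] by (intro commutator_unique) auto
    then have "commutator (x0 \<otimes> ?z) ?y [^] c = \<theta> ?y"
      using u y x0 by (simp add: commutator_mult_left \<theta>_def)
    also have "\<dots> = \<theta> y0 \<otimes> (?z [^] (- a - 1) \<otimes> ?z [^] (1::int))"
      using u y0 by (simp add: \<theta>_mult \<theta>_pow m_assoc)
    also have "\<dots> = \<theta> y0 \<otimes> ?z [^] (- a)"
      using u int_pow_mult[of ?z "- a - 1" 1] by simp
    finally have K: "commutator (x0 \<otimes> ?z) ?y [^] c = ?z [^] (- a) \<otimes> \<theta> y0"
      using u y0 \<theta>_commute by simp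
    have "(x0 \<otimes> ?z) [^] a = x0 [^] a \<otimes> ?z [^] a"
      using u x0 by (intro int_pow_mult_distrib \<theta>_commute) auto
    then have "collected a 0 c (x0 \<otimes> ?z) ?y = x0 [^] a \<otimes> (?z [^] a \<otimes> ?z [^] (- a)) \<otimes> \<theta> y0"
      using u x0 y0 y K by (simp add: collected_def m_assoc)
    also have "\<dots> = x0 [^] a \<otimes> \<theta> y0"
      using u x0 by (simp flip: int_pow_mult)
    also have "\<dots> = g" using g x0 y0 by (simp add: collected_def \<theta>_def)
    finally show ?thesis using x0 u y by (simp add: solutions_def \<phi>_def)
  qed
  ultimately show ?thesis
    unfolding order_def by (intro card_inj_on_le finite_solutions fin) auto
qed

text \<open>Euclid's algorithm as strong induction on \<open>\<bar>b\<bar>\<close>: a swap and a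
  shear replace \<open>(a, b)\<close> by \<open>(b, a mod b)\<close>, with \<open>g\<close> fixed,
  until \<open>b = 0\<close>.\<close>

lemma card_solutions:
  assumes fin: "finite (carrier G)"
  shows "solutions a b c g \<noteq> {} \<Longrightarrow> order G \<le> card (solutions a b c g)"
proof (induction "nat \<bar>b\<bar>" arbitrary: a b c rule: less_induct)
  case less
  show ?case
  proof (cases "b = 0")
    case True
    then show ?thesis using card_solutions_base fin less.prems by blast
  next
    case False
    \<comment> \<open>The swap gives the exponents \<open>(b, a)\<close> with commutator exponent
      \<open>c1\<close>; the shear by this \<open>k\<close> then turns \<open>a\<close> into
      \<open>a + k * b = a mod b\<close>.\<close>
    define k where "k = - (a div b)"
    define c1 where "c1 = - c - a * b"
    obtain c' where c': "\<And>x y. x \<in> carrier G \<Longrightarrow> y \<in> carrier G \<Longrightarrow>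
      collected b a c1 (x \<otimes> y [^] k) y = collected b (a + k * b) c' x y"
      using collected_shear by blast
    have r: "a + k * b = a mod b" by (simp add: k_def minus_div_mult_eq_mod)
    \<comment> \<open>The combined substitution, carrying solutions of the reduced equation to
      solutions of the original one. It is injective: \<open>y\<close> is visible, and
      \<open>y^k\<close> can be cancelled.\<close>
    define \<psi> where "\<psi> = (\<lambda>(x, y). (y, x \<otimes> y [^] k))"
    have coll: "collected a b c y (x \<otimes> y [^] k) = collected b (a mod b) c' x y"
      if "x \<in> carrier G" "y \<in> carrier G" for x y
      using that c' collected_swap[of "x \<otimes> y [^] k" y a b c] by (simp add: c1_def r)
    have "solutions b (a mod b) c' g \<noteq> {}"
    proof -
      from less.prems obtain y x where y: "y \<in> carrier G" and x: "x \<in> carrier G"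
        and eq: "collected a b c y x = g" by (auto simp: solutions_def)
      \<comment> \<open>The given solution is pulled back along \<open>\<psi>\<close>, so the
        reduced equation is solvable too.\<close>
      have "x \<otimes> inv (y [^] k) \<otimes> y [^] k = x" using x y by (simp add: m_assoc)
      then have "(x \<otimes> inv (y [^] k), y) \<in> solutions b (a mod b) c' g"
        using coll[of "x \<otimes> inv (y [^] k)" y] x y eq by (simp add: solutions_def)
      then show ?thesis by blast
    qed
    then have "order G \<le> card (solutions b (a mod b) c' g)"
      using less.hyps[of "a mod b" b c'] False abs_mod_less[of b a] by auto
    also have "\<dots> \<le> card (solutions a b c g)"
    proof (rule card_inj_on_le)
      show "inj_on \<psi> (solutions b (a mod b) c' g)"
        by (auto simp: \<psi>_def inj_on_def solutions_def)
      show "\<psi> ` solutions b (a mod b) c' g \<subseteq> solutions a b c g"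
        by (auto simp: \<psi>_def solutions_def coll)
    qed (rule finite_solutions[OF fin])
    finally show ?thesis .
  qed
qed

lemma word_count_ge_order:
  assumes fin: "finite (carrier G)" and w: "w \<in> carrier (free_group 2)"
    and g: "g \<in> word_values G 2 w"
  shows "order G \<le> word_count G 2 w g"
proof -
  have "fst ` set w \<subseteq> {1..2}" using w by (simp add: free_group_def)
  from word_value_collected[OF this] obtain a b c
    where val: "\<forall>h \<in> carrier (direct_power G 2). word_value G w h = collected a b c (h 1) (h 2)"
    by blast
  from g obtain h where h: "h \<in> carrier (direct_power G 2)" "word_value G w h = g"
    by (auto simp: word_values_def)
  then have "(h 1, h 2) \<in> solutions a b c g"
    using val by (auto simp: solutions_def direct_power_def PiE_iff)
  then have "order G \<le> card (solutions a b c g)"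
    using card_solutions[OF fin] by blast
  also have "\<dots> \<le> card {h \<in> carrier (direct_power G 2). word_value G w h = g}"
  proof (rule card_inj_on_le)
    \<comment> \<open>The restricted abstraction makes the function extensional, as membership in
      the direct power demands.\<close>
    let ?f = "\<lambda>(x, y). \<lambda>i \<in> {1..2::nat}. if i = 1 then x else y"
    show "inj_on ?f (solutions a b c g)"
      by (rule inj_on_inverseI[where g = "\<lambda>h. (h 1, h 2)"]) auto
    have "?f (x, y) \<in> carrier (direct_power G 2)" if "x \<in> carrier G" "y \<in> carrier G" for x y
      using that by (auto simp: direct_power_def)
    then show "?f ` solutions a b c g \<subseteq> {h \<in> carrier (direct_power G 2). word_value G w h = g}"
      by (force simp: solutions_def val)
    show "finite {h \<in> carrier (direct_power G 2). word_value G w h = g}"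
      using fin by (simp add: direct_power_def finite_PiE)
  qed
  finally show ?thesis by (simp add: word_count_def)
qed

end

section \<open>From the lower central series to central commutators\<close>

text \<open>Every \<open>[[x, y], z]\<close> is among the generators of the third term of the lower
  central series, which is \<open>lower_central G 2\<close> as the index starts at 0; that term is
  trivial, so \<open>[x, y]\<close> commutes with \<open>z\<close>.\<close>

lemma class_two_group_of_nilpotency_class:
  assumes G: "group G" and cl: "has_nilpotency_class G 2"
  shows "class_two_group G"
proof -
  interpret group G by (rule G)
  have triv: "lower_central G (Suc (Suc 0)) = {\<one>\<^bsub>G\<^esub>}"
    using cl by (simp add: has_nilpotency_class_def numeral_2_eq_2)
  show ?thesis
  proof unfold_locales
    fix x y z assume x: "x \<in> carrier G" and y: "y \<in> carrier G" and z: "z \<in> carrier G"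
    let ?c = "x \<otimes>\<^bsub>G\<^esub> y \<otimes>\<^bsub>G\<^esub> inv\<^bsub>G\<^esub> x \<otimes>\<^bsub>G\<^esub> inv\<^bsub>G\<^esub> y"
    have c: "?c \<in> carrier G" using x y by simp
    have "?c \<in> lower_central G (Suc 0)"
      using x y by (auto simp: commutator_subgroup_def intro!: generate.incl)
    then have "?c \<otimes>\<^bsub>G\<^esub> z \<otimes>\<^bsub>G\<^esub> inv\<^bsub>G\<^esub> ?c \<otimes>\<^bsub>G\<^esub> inv\<^bsub>G\<^esub> z \<in> lower_central G (Suc (Suc 0))"
      unfolding lower_central.simps(2)[of G "Suc 0"] commutator_subgroup_def
      using z by (intro generate.incl) blast
    then have "?c \<otimes>\<^bsub>G\<^esub> z \<otimes>\<^bsub>G\<^esub> inv\<^bsub>G\<^esub> ?c \<otimes>\<^bsub>G\<^esub> inv\<^bsub>G\<^esub> z = \<one>\<^bsub>G\<^esub>"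
      unfolding triv by simp
    then have "?c \<otimes>\<^bsub>G\<^esub> z \<otimes>\<^bsub>G\<^esub> inv\<^bsub>G\<^esub> (z \<otimes>\<^bsub>G\<^esub> ?c) = \<one>\<^bsub>G\<^esub>"
      using c z by (simp add: inv_mult_group m_assoc)
    then show "?c \<otimes>\<^bsub>G\<^esub> z = z \<otimes>\<^bsub>G\<^esub> ?c"
      using c z by (metis inv_closed inv_equality inv_inv m_closed)
  qed
qed

theorem theoremA:
  fixes G :: "('a, 'b) monoid_scheme" and p :: nat and w :: "letter list"
  assumes "prime p"
    and "finite_p_group p G"
    and "has_nilpotency_class G 2"
    and "w \<in> carrier (free_group 2)"
  shows "\<forall>g \<in> word_values G 2 w. word_count G 2 w g \<ge> order G"
proof -
  interpret class_two_group G
    using assms(2,3) by (auto simp: finite_p_group_def intro: class_two_group_of_nilpotency_class)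
  show ?thesis
    using assms(2,4) word_count_ge_order by (auto simp: finite_p_group_def)
qed

end
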